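(* For every integer $n\ge 4$ we have $c_{\mathcal S}(n)\ \ge\ \dfrac{\lfloor n^2/4\rfloor}{n}$.
   Context: Let $N=\{1,\dots,n\}$. A simple game on $n$ voters is a function $\chi:2^N\to\{0,1\}$ with $\chi(\emptyset)=0$, $\chi(N)=1$ and $\chi(S)\le\chi(T)$ whenever $S\subseteq T\subseteq N$; $\mathcal S_n$ is the set of all of them. A coalition $S\subseteq N$ is winning if $\chi(S)=1$ and losing if $\chi(S)=0$. For real weights $w_1,\dots,w_n$ write $w(S)=\sum_{i\in S}w_i$. For real $\alpha\ge 1$, $\chi$ is $\alpha$-roughly weighted if there are $w_1,\dots,w_n\in\mathbb R$ with $w(S)\ge 1$ for all winning $S$ and $w(S)\le\alpha$ for all losing $S$. The critical threshold value $\mu(\chi)$ is the smallest $\alpha\ge 1$ such that $\chi$ is $\alpha$-roughly weighted. Finally $c_{\mathcal S}(n)=\max\{\mu(\chi)\mid\chi\in\mathcal S_n\}$. *)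

theory Defs
  imports Complex_Main "HOL-Library.FuncSet"
begin

definition voters :: "nat \<Rightarrow> nat set" where
  "voters n = {1..n}"

text \<open>
  A game is a function on the power set of the voters only, hence the extensional
  function space: two games are equal iff they agree on all coalitions.
\<close>

definition simple_games :: "nat \<Rightarrow> (nat set \<Rightarrow> nat) set" where
  "simple_games n =
     {\<chi> \<in> Pow (voters n) \<rightarrow>\<^sub>E {0, 1}.
        \<chi> {} = 0 \<and> \<chi> (voters n) = 1 \<and>
        (\<forall>S T. S \<subseteq> T \<and> T \<subseteq> voters n \<longrightarrow> \<chi> S \<le> \<chi> T)}"

definition winning :: "nat \<Rightarrow> (nat set \<Rightarrow> nat) \<Rightarrow> nat set \<Rightarrow> bool" where
  "winning n \<chi> S \<longleftrightarrow> S \<subseteq> voters n \<and> \<chi> S = 1"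

definition losing :: "nat \<Rightarrow> (nat set \<Rightarrow> nat) \<Rightarrow> nat set \<Rightarrow> bool" where
  "losing n \<chi> S \<longleftrightarrow> S \<subseteq> voters n \<and> \<chi> S = 0"

definition roughly_weighted :: "nat \<Rightarrow> real \<Rightarrow> (nat set \<Rightarrow> nat) \<Rightarrow> bool" where
  "roughly_weighted n \<alpha> \<chi> \<longleftrightarrow>
     (\<exists>w :: nat \<Rightarrow> real.
        (\<forall>S. winning n \<chi> S \<longrightarrow> (\<Sum>i\<in>S. w i) \<ge> 1) \<and>
        (\<forall>S. losing n \<chi> S \<longrightarrow> (\<Sum>i\<in>S. w i) \<le> \<alpha>))"

text \<open>
  The minimum is attained for every simple game: by monotonicity the weights may be
  truncated to the compact box \<open>[0, 1]\<^sup>n\<close>. So \<open>Least\<close> is well defined here.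
\<close>

definition critical_threshold :: "nat \<Rightarrow> (nat set \<Rightarrow> nat) \<Rightarrow> real" where
  "critical_threshold n \<chi> = (LEAST \<alpha>. \<alpha> \<ge> 1 \<and> roughly_weighted n \<alpha> \<chi>)"

text \<open>
  \<open>simple_games n\<close> is finite, and nonempty for \<open>n \<ge> 1\<close>, so \<open>Max\<close> is meaningful.
\<close>

definition c_simple :: "nat \<Rightarrow> real" where
  "c_simple n = Max {critical_threshold n \<chi> | \<chi>. \<chi> \<in> simple_games n}"

end

(* Split the voters into two blocks of sizes p and q and let a coalition win iff it meets both.
   Summing w i + w j >= 1 over all cross pairs gives q w(A) + p w(B) >= p q, and both blocks lose,
   so the threshold is at least p q / (p + q). Weight q / n on A and p / n on B attains this value.
   The balanced split p = n div 2 has p q = floor (n^2 / 4). *)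
theory Submission
  imports Defs
begin

text \<open>\<open>simple_games\<close> lies in the extensional function space, hence the restricted
  abstraction: outside the power set of the voters the value must be
  \<open>undefined\<close>.\<close>

definition two_block_game :: "nat \<Rightarrow> nat \<Rightarrow> nat set \<Rightarrow> nat" where
  "two_block_game n p =
     (\<lambda>S\<in>Pow (voters n). if S \<inter> {1..p} \<noteq> {} \<and> S \<inter> {p<..n} \<noteq> {} then 1 else 0)"

lemma winning_two_block_game:
  "winning n (two_block_game n p) S \<longleftrightarrow>
     S \<subseteq> voters n \<and> S \<inter> {1..p} \<noteq> {} \<and> S \<inter> {p<..n} \<noteq> {}"
  by (auto simp: winning_def two_block_game_def split: if_splits)

lemma losing_two_block_game:
  "losing n (two_block_game n p) S \<longleftrightarrow>
     S \<subseteq> voters n \<and> (S \<inter> {1..p} = {} \<or> S \<inter> {p<..n} = {})"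
  by (auto simp: losing_def two_block_game_def split: if_splits)

lemma two_block_game_simple:
  assumes "1 \<le> p" "p < n"
  shows "two_block_game n p \<in> simple_games n"
proof -
  have "two_block_game n p S \<le> two_block_game n p T" if "S \<subseteq> T" "T \<subseteq> voters n" for S T
    using that by (auto simp: two_block_game_def)
  moreover have "two_block_game n p (voters n) = 1"
  proof -
    have "1 \<in> voters n \<inter> {1..p}" "n \<in> voters n \<inter> {p<..n}"
      using assms by (auto simp: voters_def)
    then show ?thesis unfolding two_block_game_def by fastforce
  qed
  moreover have "two_block_game n p \<in> Pow (voters n) \<rightarrow>\<^sub>E {0, 1}"
    by (auto simp: two_block_game_def)
  moreover have "two_block_game n p {} = 0"
    by (simp add: two_block_game_def)
  ultimately show ?thesis
    unfolding simple_games_def by blast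
qed

text \<open>\<open>Max_ge\<close> needs a finite set; this is what lets a single game bound
  \<open>c_simple\<close> from below.\<close>

lemma finite_simple_games: "finite (simple_games n)"
proof (rule finite_subset)
  show "simple_games n \<subseteq> Pow (voters n) \<rightarrow>\<^sub>E {0, 1}"
    by (auto simp: simple_games_def)
  show "finite (Pow (voters n) \<rightarrow>\<^sub>E {0, 1 :: nat})"
    by (intro finite_PiE) (auto simp: voters_def)
qed

lemma roughly_weighted_two_block_game_lower:
  assumes "p \<le> n" "roughly_weighted n \<alpha> (two_block_game n p)"
  shows "real (p * (n - p)) \<le> real n * \<alpha>"
proof -
  let ?A = "{1..p}" and ?B = "{p<..n}"
  obtain w :: "nat \<Rightarrow> real" where
    win: "\<And>S. winning n (two_block_game n p) S \<Longrightarrow> (\<Sum>i\<in>S. w i) \<ge> 1" and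
    lose: "\<And>S. losing n (two_block_game n p) S \<Longrightarrow> (\<Sum>i\<in>S. w i) \<le> \<alpha>"
    using assms(2) unfolding roughly_weighted_def by blast
  have pair: "1 \<le> w i + w j" if "i \<in> ?A" "j \<in> ?B" for i j
  proof -
    have "winning n (two_block_game n p) {i, j}"
      using that \<open>p \<le> n\<close> by (auto simp: winning_two_block_game voters_def)
    \<comment> \<open>The blocks are disjoint, so i and j differ and the sum over
      \<open>{i, j}\<close> has two terms.\<close>
    from win[OF this] show ?thesis using that by simp
  qed
  have A: "sum w ?A \<le> \<alpha>" and B: "sum w ?B \<le> \<alpha>"
    using \<open>p \<le> n\<close> by (auto intro!: lose simp: losing_two_block_game voters_def)
  have "real (p * (n - p)) = (\<Sum>i\<in>?A. \<Sum>j\<in>?B. 1)"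
    by simp
  also have "\<dots> \<le> (\<Sum>i\<in>?A. \<Sum>j\<in>?B. w i + w j)"
    by (intro sum_mono pair)
  \<comment> \<open>Each voter of one block occurs once for every partner in the other
    block.\<close>
  also have "\<dots> = real (n - p) * sum w ?A + real p * sum w ?B"
    by (simp add: sum.distrib sum_distrib_left)
  also have "\<dots> \<le> real (n - p) * \<alpha> + real p * \<alpha>"
    using A B by (intro add_mono mult_left_mono) auto
  also have "\<dots> = real n * \<alpha>"
    using \<open>p \<le> n\<close> by (simp add: of_nat_diff algebra_simps)
  finally show ?thesis .
qed

text \<open>A lower bound on all admissible values determines the \<open>LEAST\<close> only once an
  admissible value equal to it is exhibited.\<close>

lemma roughly_weighted_two_block_game_attained:
  assumes "1 \<le> p" "p < n"
  shows "roughly_weighted n (real (p * (n - p)) / real n) (two_block_game n p)"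
  unfolding roughly_weighted_def
proof (intro exI conjI allI impI)
  \<comment> \<open>Each voter gets the relative size of the opposite block, so a cross pair weighs
    exactly 1 and either full block weighs \<open>p * (n - p) / n\<close>.\<close>
  let ?w = "\<lambda>i. if i \<le> p then real (n - p) / real n else real p / real n"
  \<comment> \<open>Weights are nonnegative, so only the extreme coalitions matter: cross pairs
    among the winning ones, full blocks among the losing ones.\<close>
  have mono: "sum ?w S \<le> sum ?w T" if "S \<subseteq> T" "finite T" for S T
    using that by (intro sum_mono2) auto
  fix S
  {
    assume "winning n (two_block_game n p) S"
    then obtain i j where ij: "i \<in> S" "j \<in> S" "i \<le> p" "p < j" and S: "S \<subseteq> voters n"
      by (auto simp: winning_two_block_game)
    have "1 = sum ?w {i, j}"
      using ij assms by (auto simp: of_nat_diff field_simps)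
    also have "\<dots> \<le> sum ?w S"
      using ij S by (intro mono) (auto simp: voters_def intro: finite_subset)
    finally show "1 \<le> sum ?w S" .
  }
  {
    assume "losing n (two_block_game n p) S"
    then consider "S \<subseteq> {p<..n}" | "S \<subseteq> {1..p}"
      by (fastforce simp: losing_two_block_game voters_def)
    then show "sum ?w S \<le> real (p * (n - p)) / real n"
    proof cases
      case 1
      then have "sum ?w S \<le> sum ?w {p<..n}" by (intro mono) auto
      also have "\<dots> = (\<Sum>i\<in>{p<..n}. real p / real n)" by (intro sum.cong) auto
      finally show ?thesis by (simp add: mult.commute)
    next
      case 2
      then have "sum ?w S \<le> sum ?w {1..p}" by (intro mono) auto
      also have "\<dots> = (\<Sum>i\<in>{1..p}. real (n - p) / real n)" by (intro sum.cong) auto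
      finally show ?thesis by simp
    qed
  }
qed

text \<open>The third assumption makes the quotient at least 1; below that, the constraint
  \<open>1 \<le> \<alpha>\<close> would take over and force the threshold to be 1.\<close>

lemma critical_threshold_two_block_game:
  assumes "1 \<le> p" "p < n" "n \<le> p * (n - p)"
  shows "critical_threshold n (two_block_game n p) = real (p * (n - p)) / real n"
  unfolding critical_threshold_def
proof (rule Least_equality)
  have "real n \<le> real (p * (n - p))"
    using assms(3) by (rule of_nat_mono)
  then show "1 \<le> real (p * (n - p)) / real n \<and>
      roughly_weighted n (real (p * (n - p)) / real n) (two_block_game n p)"
    using assms roughly_weighted_two_block_game_attained[OF assms(1,2)]
    by (simp add: le_divide_eq)
next
  fix \<alpha> assume "1 \<le> \<alpha> \<and> roughly_weighted n \<alpha> (two_block_game n p)"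
  then show "real (p * (n - p)) / real n \<le> \<alpha>"
    using roughly_weighted_two_block_game_lower[of p n \<alpha>] assms
    by (simp add: divide_le_eq mult.commute)
qed

lemma floor_square_quarter:
  "\<lfloor>(real n)\<^sup>2 / 4\<rfloor> = int ((n div 2) * (n - n div 2))"
proof (cases "even n")
  case True
  then obtain k where "n = 2 * k" by blast
  moreover from this have "(real n)\<^sup>2 / 4 = real (k * k)"
    by (simp add: power2_eq_square)
  ultimately show ?thesis by (simp only: floor_of_nat) simp
next
  case False
  then obtain k where n: "n = 2 * k + 1" using oddE by blast
  \<comment> \<open>The floor discards the remainder 1/4, leaving the product of the unequal
    halves.\<close>
  have "(real n)\<^sup>2 / 4 = real (k * (k + 1)) + 1 / 4"
    by (simp add: n power2_eq_square field_simps)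
  then have "\<lfloor>(real n)\<^sup>2 / 4\<rfloor> = int (k * (k + 1))"
    by (simp add: floor_unique)
  then show ?thesis by (simp add: n)
qed

theorem proposition2:
  fixes n :: nat
  assumes "n \<ge> 4"
  shows "c_simple n \<ge> real_of_int \<lfloor>(real n)\<^sup>2 / 4\<rfloor> / real n"
proof -
  define p where "p = n div 2"
  \<comment> \<open>The bound \<open>n \<ge> 4\<close> yields \<open>2 \<le> p\<close>, and the
    second block holds at least half the voters, so n \<le> 2 (n - p) \<le> p (n - p).\<close>
  have p: "2 \<le> p" "1 \<le> p" "p < n" "n \<le> 2 * (n - p)"
    using assms by (auto simp: p_def)
  then have "n \<le> p * (n - p)"
    using mult_le_mono1[of 2 p "n - p"] by linarith
  with p have "real_of_int \<lfloor>(real n)\<^sup>2 / 4\<rfloor> / real n = critical_threshold n (two_block_game n p)"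
    by (simp add: critical_threshold_two_block_game floor_square_quarter p_def)
  also have "\<dots> \<le> c_simple n"
    unfolding c_simple_def
    using two_block_game_simple[of p n] p finite_simple_games
    by (intro Max_ge) auto
  finally show ?thesis .
qed

end
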